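(* Let $\sigma>0$, $x>0$ and $\mu\le-x$, and let $\{W_n,n\ge0\}$ be the Lindley process started at $W_0=x$ with Laplace increments with location $\mu$ and scale $\sigma$. Then $f_0(u)=\delta(u-x)$ and for $n\ge1$, $u\ge0$ the density of $W_n$ is $f_n(u)=f_n^0(u)+f_n^1(u)$, where $f_n^0(u)=c_n\delta(u)$ and $$f_n^1(u)=\Big\{\sum_{j=0}^{n-1}\frac1{(2\sigma)^n}b_n^{(1,j)}(u-(n-1)\mu)^je^{-u/\sigma}\Big\}\mathbf 1_{(0,+\infty)}(u).$$ The coefficients are determined by the initial values $$c_1=1-\tfrac12e^{(\mu+x)/\sigma},\qquad b_1^{(1,0)}=e^{(\mu+x)/\sigma},$$ and, for $n\ge1$ and $j=1,\dots,n$, the recursion $$b_{n+1}^{(1,j)}=e^{\mu/\sigma}\sum_{k=j-1}^{n-1}b_n^{(1,k)}\frac{k!}{j!}\Big(\frac\sigma2\Big)^{k-j+1},$$ $$b_{n+1}^{(1,0)}=e^{\mu/\sigma}\Big[\sum_{k=0}^{n-1}b_n^{(1,k)}\Big(-\frac{[-(n-1)\mu]^{k+1}}{k+1}+k!\Big(\frac\sigma2\Big)^{k+1}\Big)+(2\sigma)^nc_n\Big],$$ $$c_{n+1}=-\frac{e^{-\mu/\sigma}}{2^{n+1}\sigma^n}\sum_{k=0}^{n-1}b_n^{(1,k)}\frac{e^{-2(n-1)\mu/\sigma}\sigma^{k+1}}{2^{k+1}}\Gamma\Big(1+k,\frac{2(y-(n-1)\mu)}\sigma\Big)\Big|_{-\mu}^{\infty}$$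 $$-\frac1{(2\sigma)^n}\sum_{k=0}^{n-1}b_n^{(1,k)}e^{-(n-1)\mu/\sigma}\sigma^{k+1}\Gamma\Big(1+k,\frac{y-(n-1)\mu}\sigma\Big)\Big|_0^{-\mu}-\frac{e^{\mu/\sigma}}{2^{n+1}\sigma^n}\sum_{k=0}^{n-1}b_n^{(1,k)}\frac{(y-(n-1)\mu)^{k+1}}{k+1}\Big|_0^{-\mu}+\Big(1-\frac{e^{\mu/\sigma}}2\Big)c_n.$$
   Context: Lindley process with Laplace increments: $Z_1,Z_2,\dots$ are i.i.d. real random variables with density $f_Z(z)=\frac{1}{2\sigma}e^{-|z-\mu|/\sigma}$, and $W_0=x$, $W_n=\max(0,W_{n-1}+Z_n)$ for $n\ge1$. $f_n(u)=f_n(u|x)$ denotes the probability density of $W_n$ given $W_0=x$, i.e. the distributional derivative in $u$ of $\mathbb P(W_n\le u\mid W_0=x)$; it is a mixed density, consisting of an atom $c_n\delta(u)$ at $0$ (so $c_n=\mathbb P(W_n=0)$) plus an ordinary density (defined up to Lebesgue-null sets) on $(0,\infty)$. $\delta$ is the Dirac delta at $0$, with the convention that its full mass is counted on $[0,\infty)$. $\Gamma(m,y)=\int_y^\infty t^{m-1}e^{-t}\,dt$ for integers $m\ge1$ and real $y$, with $\Gamma(m,+\infty)=0$. $\phi(y)|_p^q=\phi(q)-\phi(p)$. $0^0=1$. *)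

theory Defs
  imports "HOL-Probability.Probability"
begin

definition laplace_density :: "real \<Rightarrow> real \<Rightarrow> real \<Rightarrow> real" where
  "laplace_density \<mu> \<sigma> z = 1 / (2 * \<sigma>) * exp (- \<bar>z - \<mu>\<bar> / \<sigma>)"

text \<open>The increments are indexed from 1; the value of \<open>Z 0\<close> is never used.\<close>

primrec lindley :: "real \<Rightarrow> (nat \<Rightarrow> 'a \<Rightarrow> real) \<Rightarrow> nat \<Rightarrow> 'a \<Rightarrow> real" where
  "lindley x Z 0 \<omega> = x"
| "lindley x Z (Suc n) \<omega> = max 0 (lindley x Z n \<omega> + Z (Suc n) \<omega>)"

text \<open>A distribution on the real line is represented by its action on the test functions,
  that is, on the smooth functions with compact support. Two distributions are the same if
  they agree on all test functions; their values at other functions carry no meaning.\<close>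

definition test_function :: "(real \<Rightarrow> real) \<Rightarrow> bool" where
  "test_function \<phi> \<longleftrightarrow>
     (\<forall>k. (deriv ^^ k) \<phi> differentiable_on UNIV) \<and> compact (closure {u. \<phi> u \<noteq> 0})"

type_synonym distribution = "(real \<Rightarrow> real) \<Rightarrow> real"

definition dirac :: "real \<Rightarrow> distribution" where
  "dirac a \<phi> = \<phi> a"

text \<open>The distribution given by a locally integrable function.\<close>

definition fun_distribution :: "(real \<Rightarrow> real) \<Rightarrow> distribution" where
  "fun_distribution g \<phi> = (LINT u|lborel. g u * \<phi> u)"

definition distributional_deriv :: "(real \<Rightarrow> real) \<Rightarrow> distribution" where
  "distributional_deriv F \<phi> = - (LINT u|lborel. F u * deriv \<phi> u)"

text \<open>\<open>T\<close> is the generalized density of the random variable \<open>X\<close>: the distributional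
  derivative of its distribution function.\<close>

definition has_density :: "'a measure \<Rightarrow> ('a \<Rightarrow> real) \<Rightarrow> distribution \<Rightarrow> bool" where
  "has_density M X T \<longleftrightarrow>
     (\<forall>\<phi>. test_function \<phi> \<longrightarrow>
        distributional_deriv (\<lambda>u. \<P>(\<omega> in M. X \<omega> \<le> u)) \<phi> = T \<phi>)"

text \<open>The upper incomplete Gamma function; the lower limit is an extended real, and
  the integral over the empty interval gives \<open>upper_Gamma m \<infinity> = 0\<close>.\<close>

definition upper_Gamma :: "nat \<Rightarrow> ereal \<Rightarrow> real" where
  "upper_Gamma m y = (LBINT t=y..\<infinity>. t ^ (m - 1) * exp (- t))"

text \<open>The coefficients \<open>c\<^sub>n\<close> and \<open>b\<^sub>n\<^sup>(\<^sup>1\<^sup>,\<^sup>j\<^sup>)\<close> start at \<open>n = 1\<close> and have \<open>j < n\<close>; outside this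
  range they are set to 0. Brackets \<open>\<phi>(y)|\<^sub>p\<^sup>q\<close> are written out as \<open>\<phi>(q) - \<phi>(p)\<close>.
  The exponent \<open>k - j + 1\<close> is written \<open>k + 1 - j\<close>, since for \<open>k = j - 1\<close> the former is truncated.\<close>

fun coeff_c :: "real \<Rightarrow> real \<Rightarrow> real \<Rightarrow> nat \<Rightarrow> real"
  and coeff_b :: "real \<Rightarrow> real \<Rightarrow> real \<Rightarrow> nat \<Rightarrow> nat \<Rightarrow> real" where
  "coeff_c \<sigma> \<mu> x 0 = 0"
| "coeff_c \<sigma> \<mu> x (Suc n) =
    (if n = 0 then 1 - 1 / 2 * exp ((\<mu> + x) / \<sigma>)
     else
       - (exp (- \<mu> / \<sigma>) / (2 ^ (n + 1) * \<sigma> ^ n))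
           * (\<Sum>k = 0..n - 1. coeff_b \<sigma> \<mu> x n k
                * (exp (- 2 * (real n - 1) * \<mu> / \<sigma>) * \<sigma> ^ (k + 1) / 2 ^ (k + 1))
                * (upper_Gamma (1 + k) \<infinity>
                   - upper_Gamma (1 + k) (ereal (2 * (- \<mu> - (real n - 1) * \<mu>) / \<sigma>))))
       - 1 / (2 * \<sigma>) ^ n
           * (\<Sum>k = 0..n - 1. coeff_b \<sigma> \<mu> x n k
                * exp (- (real n - 1) * \<mu> / \<sigma>) * \<sigma> ^ (k + 1)
                * (upper_Gamma (1 + k) (ereal ((- \<mu> - (real n - 1) * \<mu>) / \<sigma>))
                   - upper_Gamma (1 + k) (ereal ((0 - (real n - 1) * \<mu>) / \<sigma>))))
       - exp (\<mu> / \<sigma>) / (2 ^ (n + 1) * \<sigma> ^ n)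
           * (\<Sum>k = 0..n - 1. coeff_b \<sigma> \<mu> x n k
                * ((- \<mu> - (real n - 1) * \<mu>) ^ (k + 1) / real (k + 1)
                   - (0 - (real n - 1) * \<mu>) ^ (k + 1) / real (k + 1)))
       + (1 - exp (\<mu> / \<sigma>) / 2) * coeff_c \<sigma> \<mu> x n)"
| "coeff_b \<sigma> \<mu> x 0 j = 0"
| "coeff_b \<sigma> \<mu> x (Suc n) j =
    (if n = 0 then (if j = 0 then exp ((\<mu> + x) / \<sigma>) else 0)
     else if j = 0 then
       exp (\<mu> / \<sigma>)
         * ((\<Sum>k = 0..n - 1. coeff_b \<sigma> \<mu> x n k
               * (- ((- (real n - 1) * \<mu>) ^ (k + 1) / real (k + 1))
                  + fact k * (\<sigma> / 2) ^ (k + 1)))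
            + (2 * \<sigma>) ^ n * coeff_c \<sigma> \<mu> x n)
     else
       exp (\<mu> / \<sigma>)
         * (\<Sum>k = j - 1..n - 1. coeff_b \<sigma> \<mu> x n k
              * (fact k / fact j) * (\<sigma> / 2) ^ (k + 1 - j)))"

definition ordinary_part :: "real \<Rightarrow> real \<Rightarrow> real \<Rightarrow> nat \<Rightarrow> real \<Rightarrow> real" where
  "ordinary_part \<sigma> \<mu> x n u =
     (\<Sum>j = 0..n - 1. 1 / (2 * \<sigma>) ^ n * coeff_b \<sigma> \<mu> x n j
        * (u - (real n - 1) * \<mu>) ^ j * exp (- u / \<sigma>)) * indicator {0<..} u"

end

theory Submission
  imports Defs
begin

text \<open>
  The law of \<open>W\<^sub>n\<close> is a point mass \<open>c\<^sub>n\<close> at 0 plus an absolutely continuous part \<open>g\<^sub>n\<close> on the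
  positive half-line. Such mixed laws, taken as functionals on bounded Borel functions
  (\<open>mixed_law\<close>), are stable under one Lindley step: conditioning on the independent increment
  with density \<open>f\<close> and distribution function \<open>F\<close>, the new mass at 0 is
  \<open>c\<^sub>n F(0) + \<integral> g\<^sub>n(w) F(-w) dw\<close>, since all paths pushed below 0 are collected there, and the new
  ordinary part at \<open>u > 0\<close> is \<open>c\<^sub>n f(u) + \<integral> g\<^sub>n(w) f(u - w) dw\<close>
  (\<open>mixed_law_lindley_step\<close>). The start is the point mass at \<open>x\<close>.

  Everything else is the evaluation of these integrals for the Laplace density. Since
  \<open>\<mu> \<le> 0\<close>, the kinks of \<open>w \<mapsto> F(-w)\<close> and \<open>w \<mapsto> f(u - w)\<close>, at \<open>w = -\<mu>\<close> and at \<open>w = u - \<mu>\<close>, lie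
  in the half-line \<open>w \<ge> 0\<close> for every \<open>u > 0\<close>, so there is no case distinction in \<open>u\<close>; and \<open>\<mu> \<le> -x\<close>
  gives the same for the first step. On \<open>g\<^sub>n\<close>, a polynomial in \<open>u - (n - 1)\<mu>\<close> times \<open>exp (-u/\<sigma>)\<close>,
  the part of the integral below the kink has its exponentials cancelled, so that it
  raises the degree of the polynomial by one, and the part above it is an incomplete Gamma integral
  with a rate of \<open>2/\<sigma>\<close>. The result is centred at \<open>n\<mu>\<close>, and its coefficients
  obey the recursion (\<open>coeff_c_step\<close>, \<open>ordinary_part_step\<close>).

  By Fubini the distributional derivative of a distribution function, tested against \<open>\<phi>\<close>, is the
  expectation of \<open>\<phi>\<close> (\<open>distributional_deriv_cdf\<close>), so the generalized density can be read off
  from the mixed law. Applied to the indicator of \<open>{0}\<close>, the mixed law identifies \<open>c\<^sub>n\<close>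
  as the probability of \<open>W\<^sub>n = 0\<close>.
\<close>

section \<open>Incomplete Gamma integrals\<close>

text \<open>The elementary closed form of \<open>\<Gamma>(k + 1, s)\<close>; the recursion needs its polynomial factor.\<close>

definition gamma_tail :: "nat \<Rightarrow> real \<Rightarrow> real" where
  "gamma_tail k s = exp (- s) * (\<Sum>i\<le>k. fact k / fact i * s ^ i)"

text \<open>Integration by parts for the incomplete Gamma function.\<close>

lemma gamma_tail_Suc: "gamma_tail (Suc k) s = real (Suc k) * gamma_tail k s + s ^ Suc k * exp (- s)"
proof -
  have "(\<Sum>i\<le>k. fact (Suc k) / fact i * s ^ i) = real (Suc k) * (\<Sum>i\<le>k. fact k / fact i * s ^ i)"
    by (simp add: sum_distrib_left del: of_nat_Suc) (simp add: mult.assoc)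
  then show ?thesis
    by (simp add: gamma_tail_def algebra_simps del: fact_Suc)
qed

lemma DERIV_gamma_tail: "(gamma_tail k has_real_derivative - (s ^ k * exp (- s))) (at s)"
proof (induction k)
  case 0
  have "((\<lambda>s. exp (- s)) has_real_derivative - exp (- s)) (at s)"
    by (auto intro!: derivative_eq_intros)
  moreover have "gamma_tail 0 = (\<lambda>s. exp (- s))"
    by (auto simp: gamma_tail_def)
  ultimately show ?case by simp
next
  case (Suc k)
  have "((\<lambda>s. real (Suc k) * gamma_tail k s + s ^ Suc k * exp (- s)) has_real_derivative
      real (Suc k) * - (s ^ k * exp (- s)) + (real (Suc k) * s ^ k * exp (- s) - s ^ Suc k * exp (- s))) (at s)"
    by (rule derivative_eq_intros Suc refl)+ (simp add: algebra_simps)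
  then show ?case
    by (simp add: gamma_tail_Suc[abs_def] algebra_simps)
qed

lemma gamma_tail_at_top: "(gamma_tail k \<longlongrightarrow> 0) at_top"
proof -
  have "((\<lambda>s. \<Sum>i\<le>k. fact k / fact i * (s ^ i / exp s)) \<longlongrightarrow> (\<Sum>i\<le>k. fact k / fact i * 0 :: real)) at_top"
    by (intro tendsto_intros tendsto_power_div_exp_0)
  moreover have "gamma_tail k = (\<lambda>s. \<Sum>i\<le>k. fact k / fact i * (s ^ i / exp s))"
    by (auto simp: gamma_tail_def sum_distrib_left exp_minus field_simps)
  ultimately show ?thesis by simp
qed

text \<open>The substitution \<open>t = a(y - q)\<close> turns the integral into \<open>\<Gamma>(k + 1, a(p - q))\<close>; the bound \<open>q \<le> p\<close>
  makes the integrand nonnegative, so that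
  integrability follows from the finite limit of the antiderivative.\<close>

lemma has_bochner_integral_gamma_tail:
  assumes "a > 0" "q \<le> p"
  shows "has_bochner_integral lborel (\<lambda>y. indicator {p<..} y * ((y - q) ^ k * exp (- a * y)))
           (exp (- a * q) / a ^ (k + 1) * gamma_tail k (a * (p - q)))"
proof -
  define C where "C = exp (- a * q) / a ^ (k + 1)"
  define F where "F y = - C * gamma_tail k (a * (y - q))" for y
  have D: "(F has_real_derivative (y - q) ^ k * exp (- a * y)) (at y)" for y
  proof -
    have "((\<lambda>y. gamma_tail k (a * (y - q))) has_real_derivative
            - ((a * (y - q)) ^ k * exp (- (a * (y - q)))) * a) (at y)"
      by (rule DERIV_chain2[OF DERIV_gamma_tail]) (auto intro!: derivative_eq_intros)
    then have "(F has_real_derivative - C * (- ((a * (y - q)) ^ k * exp (- (a * (y - q)))) * a)) (at y)"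
      unfolding F_def by (rule DERIV_cmult)
    moreover have "- C * (- ((a * (y - q)) ^ k * exp (- (a * (y - q)))) * a) = (y - q) ^ k * exp (- a * y)"
    proof -
      have "exp (- (a * (y - q))) = exp (- a * y) * exp (a * q)"
        by (simp add: exp_add[symmetric] right_diff_distrib)
      then have "- C * (- ((a * (y - q)) ^ k * exp (- (a * (y - q)))) * a)
          = (exp (- a * q) * exp (a * q)) * (a ^ (k + 1) / a ^ (k + 1)) * ((y - q) ^ k * exp (- a * y))"
        by (simp add: C_def power_mult_distrib mult_ac)
      also have "exp (- a * q) * exp (a * q) = 1"
        by (simp add: exp_minus)
      finally show ?thesis using assms by simp
    qed
    ultimately show ?thesis by simp
  qed
  have lim_top: "((F \<circ> real_of_ereal) \<longlongrightarrow> 0) (at_left \<infinity>)"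
  proof -
    have "filterlim (\<lambda>y. - (a * q) + a * y) at_top at_top"
      by (intro filterlim_tendsto_add_at_top[OF tendsto_const]
          filterlim_tendsto_pos_mult_at_top[OF tendsto_const] assms filterlim_ident)
    then have "filterlim (\<lambda>y. a * (y - q)) at_top at_top"
      by (simp add: algebra_simps)
    then have "((\<lambda>y. gamma_tail k (a * (y - q))) \<longlongrightarrow> 0) at_top"
      by (rule filterlim_compose[OF gamma_tail_at_top])
    from tendsto_mult_left[OF this, of "- C"] show ?thesis
      by (simp add: ereal_tendsto_simps F_def[abs_def])
  qed
  have lim_p: "((F \<circ> real_of_ereal) \<longlongrightarrow> F p) (at_right (ereal p))"
    using DERIV_isCont[OF D, of p]
    by (simp add: ereal_tendsto_simps isCont_def filterlim_at_split)
  have ae: "AE y in lborel. ereal p < ereal y \<longrightarrow> ereal y < \<infinity> \<longrightarrow> 0 \<le> (y - q) ^ k * exp (- a * y)"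
    using assms by (intro AE_I2) auto
  note ftc = interval_integral_FTC_nonneg[of "ereal p" \<infinity> F, OF _ D _ ae lim_p lim_top]
  have cont: "isCont (\<lambda>y. (y - q) ^ k * exp (- a * y)) y" for y
    by (intro continuous_intros)
  have "set_integrable lborel {p<..} (\<lambda>y. (y - q) ^ k * exp (- a * y))"
    using ftc(1)[OF _ cont] by simp
  moreover have "(LINT y:{p<..}|lborel. (y - q) ^ k * exp (- a * y)) = C * gamma_tail k (a * (p - q))"
    using ftc(2)[OF _ cont] by (simp add: interval_lebesgue_integral_def F_def)
  ultimately show ?thesis
    by (simp add: has_bochner_integral_iff set_integrable_def set_lebesgue_integral_def C_def)
qed

lemma upper_Gamma_eq_gamma_tail:
  assumes "s \<ge> 0"
  shows "upper_Gamma (1 + k) (ereal s) = gamma_tail k s"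
  using has_bochner_integral_gamma_tail[of 1 0 s k] assms
  by (simp add: upper_Gamma_def interval_lebesgue_integral_def set_lebesgue_integral_def
      has_bochner_integral_iff)

lemma upper_Gamma_infinity: "upper_Gamma m \<infinity> = 0"
  by (simp add: upper_Gamma_def)

lemma has_bochner_integral_shifted_power:
  fixes p q :: real
  assumes "p \<ge> 0"
  shows "has_bochner_integral lborel (\<lambda>w. indicator {0<..p} w * (w - q) ^ k)
           (((p - q) ^ (k + 1) - (0 - q) ^ (k + 1)) / real (k + 1))"
proof -
  have D: "((\<lambda>w. (w - q) ^ (k + 1) / real (k + 1)) has_real_derivative (w - q) ^ k) (at w)" for w
    by (auto intro!: derivative_eq_intros simp del: of_nat_Suc power_Suc) 
  have closed: "has_bochner_integral lborel (\<lambda>w. (w - q) ^ k * indicator {0..p} w)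
       ((p - q) ^ (k + 1) / real (k + 1) - (0 - q) ^ (k + 1) / real (k + 1))"
    using assms by (intro has_bochner_integral_FTC_Icc_real D continuous_intros)
  have ae: "AE w in lborel. (w - q) ^ k * indicator {0..p} w = indicator {0<..p} w * (w - q) ^ k"
    using AE_lborel_singleton[of 0] by eventually_elim (auto simp: indicator_def)
  have "has_bochner_integral lborel (\<lambda>w. indicator {0<..p} w * (w - q) ^ k)
       ((p - q) ^ (k + 1) / real (k + 1) - (0 - q) ^ (k + 1) / real (k + 1))"
    by (rule iffD1[OF has_bochner_integral_cong_AE[OF _ _ ae] closed]) measurable
  then show ?thesis by (simp only: diff_divide_distrib)
qed

section \<open>The Laplace distribution function\<close>

lemma borel_measurable_laplace_density [measurable]: "laplace_density \<mu> \<sigma> \<in> borel_measurable borel"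
  unfolding laplace_density_def[abs_def] by measurable

lemma laplace_density_nonneg: "\<sigma> > 0 \<Longrightarrow> laplace_density \<mu> \<sigma> z \<ge> 0"
  by (simp add: laplace_density_def)

lemma laplace_upper_tail:
  assumes "\<sigma> > 0" "\<mu> \<le> t"
  shows "has_bochner_integral lborel (\<lambda>z. indicator {t<..} z * laplace_density \<mu> \<sigma> z)
           (1 / 2 * exp ((\<mu> - t) / \<sigma>))"
proof -
  have "has_bochner_integral lborel
     (\<lambda>z. exp (\<mu> / \<sigma>) / (2 * \<sigma>) * (indicator {t<..} z * ((z - t) ^ 0 * exp (- (1 / \<sigma>) * z))))
     (exp (\<mu> / \<sigma>) / (2 * \<sigma>) * (exp (- (1 / \<sigma>) * t) / (1 / \<sigma>) ^ (0 + 1) * gamma_tail 0 (1 / \<sigma> * (t - t))))"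
    using assms by (intro has_bochner_integral_mult_right has_bochner_integral_gamma_tail) auto
  moreover have "exp (\<mu> / \<sigma>) / (2 * \<sigma>) * (indicator {t<..} z * ((z - t) ^ 0 * exp (- (1 / \<sigma>) * z)))
      = indicator {t<..} z * laplace_density \<mu> \<sigma> z" for z
  proof (cases "z > t")
    case True
    have "exp (\<mu> / \<sigma>) * exp (- (1 / \<sigma>) * z) = exp (- (z - \<mu>) / \<sigma>)"
      by (simp add: exp_add[symmetric] diff_divide_distrib)
    with True assms show ?thesis by (simp add: laplace_density_def)
  qed simp
  moreover have "exp (\<mu> / \<sigma>) / (2 * \<sigma>) * (exp (- (1 / \<sigma>) * t) / (1 / \<sigma>) ^ (0 + 1) * gamma_tail 0 (1 / \<sigma> * (t - t)))
      = 1 / 2 * exp ((\<mu> - t) / \<sigma>)"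
  proof -
    have "exp (\<mu> / \<sigma>) * exp (- (1 / \<sigma>) * t) = exp ((\<mu> - t) / \<sigma>)"
      by (simp add: exp_add[symmetric] diff_divide_distrib)
    then show ?thesis using assms by (simp add: gamma_tail_def)
  qed
  ultimately show ?thesis by (simp only:)
qed

text \<open>The density is symmetric about \<open>\<mu>\<close>, so this is the reflected upper tail.\<close>

lemma laplace_lower_tail:
  assumes "\<sigma> > 0" "t \<le> \<mu>"
  shows "has_bochner_integral lborel (\<lambda>z. indicator {..t} z * laplace_density \<mu> \<sigma> z)
           (1 / 2 * exp ((t - \<mu>) / \<sigma>))"
proof -
  have "has_bochner_integral lborel
      (\<lambda>z. indicator {2 * \<mu> - t<..} (2 * \<mu> + -1 * z) * laplace_density \<mu> \<sigma> (2 * \<mu> + -1 * z))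
      (1 / 2 * exp ((\<mu> - (2 * \<mu> - t)) / \<sigma>) /\<^sub>R \<bar>-1\<bar>)"
    using assms by (intro lborel_has_bochner_integral_real_affine_iff[THEN iffD1] laplace_upper_tail) auto
  moreover have "laplace_density \<mu> \<sigma> (2 * \<mu> + -1 * z) = laplace_density \<mu> \<sigma> z" for z
    using abs_minus_commute[of \<mu> z] by (simp add: laplace_density_def)
  ultimately have reflected: "has_bochner_integral lborel
      (\<lambda>z. indicator {2 * \<mu> - t<..} (2 * \<mu> - z) * laplace_density \<mu> \<sigma> z) (1 / 2 * exp ((t - \<mu>) / \<sigma>))"
    by (simp add: algebra_simps)
  have ae: "AE z in lborel. indicator {2 * \<mu> - t<..} (2 * \<mu> - z) * laplace_density \<mu> \<sigma> z
      = indicator {..t} z * laplace_density \<mu> \<sigma> z"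
    using AE_lborel_singleton[of t] by eventually_elim (auto simp: indicator_def)
  show ?thesis
    by (rule iffD1[OF has_bochner_integral_cong_AE[OF _ _ ae] reflected]) measurable
qed

lemma laplace_density_total:
  assumes "\<sigma> > 0"
  shows "has_bochner_integral lborel (laplace_density \<mu> \<sigma>) 1"
proof -
  have "has_bochner_integral lborel (\<lambda>z. indicator {..\<mu>} z * laplace_density \<mu> \<sigma> z
      + indicator {\<mu><..} z * laplace_density \<mu> \<sigma> z) (1 / 2 * exp ((\<mu> - \<mu>) / \<sigma>) + 1 / 2 * exp ((\<mu> - \<mu>) / \<sigma>))"
    using assms by (intro has_bochner_integral_add laplace_lower_tail laplace_upper_tail) auto
  moreover have "indicator {..\<mu>} z * laplace_density \<mu> \<sigma> z
      + indicator {\<mu><..} z * laplace_density \<mu> \<sigma> z = laplace_density \<mu> \<sigma> z" for z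
    by (auto simp: indicator_def)
  ultimately show ?thesis by simp
qed

definition density_cdf :: "(real \<Rightarrow> real) \<Rightarrow> real \<Rightarrow> real" where
  "density_cdf f t = (LINT z|lborel. indicator {..t} z * f z)"

lemma density_cdf_laplace_le:
  assumes "\<sigma> > 0" "t \<le> \<mu>"
  shows "density_cdf (laplace_density \<mu> \<sigma>) t = 1 / 2 * exp ((t - \<mu>) / \<sigma>)"
  using laplace_lower_tail[OF assms] by (simp add: density_cdf_def has_bochner_integral_iff)

lemma density_cdf_laplace_ge:
  assumes "\<sigma> > 0" "\<mu> \<le> t"
  shows "density_cdf (laplace_density \<mu> \<sigma>) t = 1 - 1 / 2 * exp ((\<mu> - t) / \<sigma>)"
proof -
  have "has_bochner_integral lborel (\<lambda>z. laplace_density \<mu> \<sigma> z - indicator {t<..} z * laplace_density \<mu> \<sigma> z)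
      (1 - 1 / 2 * exp ((\<mu> - t) / \<sigma>))"
    using assms by (intro has_bochner_integral_diff laplace_density_total laplace_upper_tail)
  moreover have "laplace_density \<mu> \<sigma> z - indicator {t<..} z * laplace_density \<mu> \<sigma> z
      = indicator {..t} z * laplace_density \<mu> \<sigma> z" for z
    by (auto simp: indicator_def)
  ultimately show ?thesis
    by (simp add: density_cdf_def has_bochner_integral_iff)
qed

section \<open>Mixed laws and one Lindley step\<close>

text \<open>The law of \<open>X\<close> is \<open>c \<delta>\<^sub>a + g(u) du\<close>. It is tested against bounded Borel functions
  because these are closed under averaging over an increment and contain the indicator of the atom.
  The position of the atom is a parameter, so that the deterministic start is a mixed law too.
  As the signs of the coefficients cannot be seen from their recursion, \<open>g\<close> is asked to be
  integrable rather than nonnegative.\<close>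

definition mixed_law :: "'a measure \<Rightarrow> ('a \<Rightarrow> real) \<Rightarrow> real \<Rightarrow> real \<Rightarrow> (real \<Rightarrow> real) \<Rightarrow> bool" where
  "mixed_law M X a c g \<longleftrightarrow> X \<in> borel_measurable M \<and> integrable lborel g \<and>
     (\<forall>h K. h \<in> borel_measurable borel \<longrightarrow> (\<forall>u. \<bar>h u\<bar> \<le> K) \<longrightarrow>
        (LINT \<omega>|M. h (X \<omega>)) = c * h a + (LINT u|lborel. g u * h u))"

lemma mixed_lawD:
  fixes h :: "real \<Rightarrow> real"
  assumes "mixed_law M X a c g" "h \<in> borel_measurable borel" "\<And>u. \<bar>h u\<bar> \<le> K"
  shows "(LINT \<omega>|M. h (X \<omega>)) = c * h a + (LINT u|lborel. g u * h u)"
  using assms unfolding mixed_law_def by blast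

lemma mixed_law_prob_atom:
  assumes "prob_space M" "mixed_law M X a c g"
  shows "\<P>(\<omega> in M. X \<omega> = a) = c"
proof -
  interpret prob_space M by fact
  have [measurable]: "X \<in> borel_measurable M"
    using assms by (simp add: mixed_law_def)
  have "\<P>(\<omega> in M. X \<omega> = a) = (LINT \<omega>|M. indicator {\<omega> \<in> space M. X \<omega> = a} \<omega>)"
    by simp
  also have "\<dots> = (LINT \<omega>|M. indicator {a} (X \<omega>))"
    by (intro Bochner_Integration.integral_cong) (auto simp: indicator_def)
  also have "\<dots> = c * indicator {a} a + (LINT u|lborel. g u * indicator {a} u)"
    by (rule mixed_lawD[OF assms(2), where K = 1]) (auto simp: indicator_def)
  also have "(LINT u|lborel. g u * indicator {a} u) = 0"
  proof (rule integral_eq_zero_AE)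
    show "AE u in lborel. g u * indicator {a} u = 0"
      using AE_lborel_singleton[of a] by eventually_elim simp
  qed
  finally show ?thesis by simp
qed

lemma mixed_law_const:
  assumes "prob_space M"
  shows "mixed_law M (\<lambda>_. a) a 1 (\<lambda>_. 0)"
proof -
  interpret prob_space M by fact
  show ?thesis by (simp add: mixed_law_def prob_space)
qed

text \<open>Substitute \<open>u = w + z\<close> and split at 0: the half-line \<open>u \<le> 0\<close> is mapped to the single point 0
  and contributes the distribution function.\<close>

lemma expectation_lindley_step:
  fixes f :: "real \<Rightarrow> real" and h :: "real \<Rightarrow> real"
  assumes f[measurable]: "integrable lborel f" and f_nonneg: "\<And>z. f z \<ge> 0"
    and h[measurable]: "h \<in> borel_measurable borel" and hK: "\<And>u. \<bar>h u\<bar> \<le> K"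
  shows "(LINT z|lborel. f z * h (max 0 (w + z)))
     = h 0 * density_cdf f (- w) + (LINT u|lborel. indicator {0<..} u * h u * f (u - w))"
    and "integrable lborel (\<lambda>u. indicator {0<..} u * h u * f (u - w))"
proof -
  have fs: "integrable lborel (\<lambda>u. f (u - w))"
    using lborel_integrable_real_affine[OF f, of 1 "- w"] by simp
  have int1: "integrable lborel (\<lambda>z. h 0 * (indicator {..- w} z * f z))"
    using integrable_real_mult_indicator[OF _ f, of "{..- w}"]
    by (intro integrable_mult_right) (simp add: mult.commute)
  show int2: "integrable lborel (\<lambda>u. indicator {0<..} u * h u * f (u - w))"
  proof (rule Bochner_Integration.integrable_bound[OF integrable_mult_right[OF fs, of K]])
    show "AE u in lborel. norm (indicator {0<..} u * h u * f (u - w)) \<le> norm (K * f (u - w))"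
      using hK order_trans[OF abs_ge_zero hK] by (intro AE_I2) (auto simp: abs_mult indicator_def f_nonneg intro!: mult_right_mono)
  qed measurable
  have eq: "f z * h (max 0 (w + z)) = h 0 * (indicator {..- w} z * f z)
     + indicator {0<..} (w + z) * h (w + z) * f z" for z
    by (auto simp: indicator_def max_def)
  have int3: "has_bochner_integral lborel (\<lambda>z. indicator {0<..} (w + z) * h (w + z) * f z)
       (LINT u|lborel. indicator {0<..} u * h u * f (u - w))"
    using lborel_has_bochner_integral_real_affine_iff[of 1 "\<lambda>u. indicator {0<..} u * h u * f (u - w)" _ w]
      has_bochner_integral_integrable[OF int2] by simp
  show "(LINT z|lborel. f z * h (max 0 (w + z)))
     = h 0 * density_cdf f (- w) + (LINT u|lborel. indicator {0<..} u * h u * f (u - w))"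
    unfolding eq density_cdf_def
    by (subst Bochner_Integration.integral_add[OF int1]) (use int3 in \<open>auto simp: has_bochner_integral_iff\<close>)
qed

text \<open>Averaging first over \<open>Y\<close> replaces \<open>h\<close> by the bounded function \<open>H\<close> of
  \<open>expectation_lindley_step\<close>, to which the law of \<open>X\<close> applies; exchanging the two integrals in
  \<open>\<integral> g H\<close> exhibits the new ordinary part.\<close>

lemma mixed_law_lindley_step:
  fixes f :: "real \<Rightarrow> real"
  assumes M: "prob_space M" and X: "mixed_law M X a c g"
    and ind: "prob_space.indep_var M borel X borel Y"
    and Y: "distributed M lborel Y (\<lambda>z. ennreal (f z))"
    and f: "integrable lborel f" and f_nonneg: "\<And>z. f z \<ge> 0"
  shows "mixed_law M (\<lambda>\<omega>. max 0 (X \<omega> + Y \<omega>)) 0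
     (c * density_cdf f (- a) + (LINT w|lborel. g w * density_cdf f (- w)))
     (\<lambda>u. indicator {0<..} u * (c * f (u - a) + (LINT w|lborel. g w * f (u - w))))"
proof -
  interpret prob_space M by fact
  have [measurable]: "X \<in> borel_measurable M" "Y \<in> borel_measurable M"
    using indep_var_rv1[OF ind] indep_var_rv2[OF ind] by auto
  have fm[measurable]: "f \<in> borel_measurable borel" using f by auto
  have g: "integrable lborel g" using X by (simp add: mixed_law_def)
  have gm[measurable]: "g \<in> borel_measurable borel" using g by auto
  define If where "If = (LINT z|lborel. f z)"
  have If: "(LINT u|lborel. f (u - w)) = If" and fs: "integrable lborel (\<lambda>u. f (u - w))" for w
    using lborel_integral_real_affine[of 1 f "- w"] lborel_integrable_real_affine[OF f, of 1 "- w"]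
    by (simp_all add: If_def)
  have abs_f: "\<bar>f z\<bar> = f z" for z using f_nonneg by simp
  \<comment> \<open>The convolution integrand dominates, up to the bound of \<open>h\<close>, the one for each test function \<open>h\<close>.\<close>
  have int_gf: "integrable (lborel \<Otimes>\<^sub>M lborel) (\<lambda>(w, u). g w * f (u - w))"
  proof (rule lborel_pair.Fubini_integrable)
    show "integrable lborel (\<lambda>w. LINT u|lborel. norm (case (w, u) of (w, u) \<Rightarrow> g w * f (u - w)))"
      using g by (simp add: abs_mult abs_f If)
  qed (auto intro!: integrable_mult_right fs)
  have int_conv: "integrable lborel (\<lambda>u. LINT w|lborel. g w * f (u - w))"
    using lborel_pair.integrable_snd[of "\<lambda>w u. g w * f (u - w)"] int_gf by simp
  define G where "G u = c * f (u - a) + (LINT w|lborel. g w * f (u - w))" for u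
  have G: "integrable lborel G"
    unfolding G_def[abs_def] by (intro Bochner_Integration.integrable_add integrable_mult_right fs int_conv)
  have int_new: "integrable lborel (\<lambda>u. indicator {0<..} u * G u)"
    using integrable_real_mult_indicator[OF _ G, of "{0<..}"] by (simp add: mult.commute)
  have cdf_m[measurable]: "(\<lambda>w. density_cdf f (- w)) \<in> borel_measurable borel"
    unfolding density_cdf_def indicator_def atMost_def by measurable
  have cdf_bound: "\<bar>density_cdf f t\<bar> \<le> If" for t
  proof -
    have i: "integrable lborel (\<lambda>z. indicator {..t} z * f z)"
      using integrable_real_mult_indicator[OF _ f, of "{..t}"] by (simp add: mult.commute)
    have "0 \<le> density_cdf f t"
      unfolding density_cdf_def by (intro integral_nonneg_AE AE_I2) (simp add: f_nonneg)
    moreover have "density_cdf f t \<le> If"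
      unfolding density_cdf_def If_def
      by (rule integral_mono[OF i f]) (simp add: f_nonneg indicator_def)
    ultimately show ?thesis by simp
  qed
  have main: "(LINT \<omega>|M. h (max 0 (X \<omega> + Y \<omega>)))
       = (c * density_cdf f (- a) + (LINT w|lborel. g w * density_cdf f (- w))) * h 0
         + (LINT u|lborel. indicator {0<..} u * G u * h u)"
    if h[measurable]: "h \<in> borel_measurable borel" and hK: "\<And>u. \<bar>h u\<bar> \<le> K" for h :: "real \<Rightarrow> real" and K
  proof -
    define H where "H w = h 0 * density_cdf f (- w) + (LINT u|lborel. indicator {0<..} u * h u * f (u - w))" for w
    note step = expectation_lindley_step[OF f f_nonneg h hK]
    have H_eq: "H w = (LINT z|lborel. f z * h (max 0 (w + z)))" for w
      unfolding H_def by (rule step(1)[symmetric])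
    have K0: "K \<ge> 0" using hK[of 0] by linarith
    have [measurable]: "H \<in> borel_measurable borel"
      unfolding H_eq[abs_def] by measurable
    have H_bound: "\<bar>H w\<bar> \<le> K * If" for w
    proof -
      have "\<bar>H w\<bar> \<le> (LINT z|lborel. K * f z)"
        unfolding H_eq
      proof (rule integral_abs_bound_integral)
        show i: "integrable lborel (\<lambda>z. f z * h (max 0 (w + z)))"
          by (rule Bochner_Integration.integrable_bound[OF integrable_mult_right[OF f, of K]])
            (auto simp: abs_mult abs_f K0 mult.commute[of K] intro!: mult_left_mono hK f_nonneg)
        show "\<bar>f z * h (max 0 (w + z))\<bar> \<le> K * f z" for z
          by (auto simp: abs_mult abs_f K0 mult.commute[of K] intro!: mult_left_mono hK f_nonneg)
      qed (use f in auto)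
      then show ?thesis by (simp add: If_def)
    qed
    let ?DX = "distr M borel X" and ?DY = "distr M borel Y"
    interpret DX: prob_space ?DX by (rule prob_space_distr) measurable
    interpret DY: prob_space ?DY by (rule prob_space_distr) measurable
    interpret D: pair_prob_space ?DX ?DY ..
    have "(LINT \<omega>|M. h (max 0 (X \<omega> + Y \<omega>)))
       = (LINT p|(distr M (borel \<Otimes>\<^sub>M borel) (\<lambda>\<omega>. (X \<omega>, Y \<omega>))). h (max 0 (fst p + snd p)))"
      by (subst integral_distr) auto
    also have "\<dots> = (LINT p|(?DX \<Otimes>\<^sub>M ?DY). (\<lambda>(w, z). h (max 0 (w + z))) p)"
      using ind by (simp add: indep_var_distribution_eq case_prod_beta')
    also have "\<dots> = (LINT w|?DX. LINT z|?DY. h (max 0 (w + z)))"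
      by (subst D.integral_fst[symmetric])
        (auto intro!: D.P.integrable_const_bound[where B = K] hK)
    also have "\<dots> = (LINT w|?DX. H w)"
    proof (rule Bochner_Integration.integral_cong[OF refl])
      fix w
      have "(LINT z|?DY. h (max 0 (w + z))) = (LINT \<omega>|M. h (max 0 (w + Y \<omega>)))"
        by (rule integral_distr) measurable
      also have "\<dots> = H w"
        unfolding H_eq by (rule distributed_integral[OF Y, symmetric]) (auto simp: f_nonneg)
      finally show "(LINT z|?DY. h (max 0 (w + z))) = H w" .
    qed
    also have "\<dots> = (LINT \<omega>|M. H (X \<omega>))"
      by (rule integral_distr) measurable
    also have "\<dots> = c * H a + (LINT w|lborel. g w * H w)"
      by (rule mixed_lawD[OF X _ H_bound]) measurable
    also have "(LINT w|lborel. g w * H w)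
        = h 0 * (LINT w|lborel. g w * density_cdf f (- w))
          + (LINT u|lborel. indicator {0<..} u * h u * (LINT w|lborel. g w * f (u - w)))"
    proof -
      have int_gfh: "integrable (lborel \<Otimes>\<^sub>M lborel) (\<lambda>(w, u). g w * (indicator {0<..} u * h u * f (u - w)))"
      proof (rule Bochner_Integration.integrable_bound[OF integrable_mult_right[OF int_gf, of K]])
        show "AE p in lborel \<Otimes>\<^sub>M lborel. norm (case p of (w, u) \<Rightarrow> g w * (indicator {0<..} u * h u * f (u - w)))
            \<le> norm (K * (case p of (w, u) \<Rightarrow> g w * f (u - w)))"
        proof (rule AE_I2, clarify)
          fix w u :: real
          have "\<bar>indicator {0<..} u * h u\<bar> * \<bar>g w * f (u - w)\<bar> \<le> K * \<bar>g w * f (u - w)\<bar>"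
            using hK[of u] K0 by (intro mult_right_mono) (auto simp: indicator_def)
          then show "norm (g w * (indicator {0<..} u * h u * f (u - w))) \<le> norm (K * (g w * f (u - w)))"
            using K0 by (simp add: abs_mult mult_ac)
        qed
      qed measurable
      have i1: "integrable lborel (\<lambda>w. g w * density_cdf f (- w))"
      proof (rule Bochner_Integration.integrable_bound[OF integrable_mult_right[OF g, of If]])
        show "AE w in lborel. norm (g w * density_cdf f (- w)) \<le> norm (If * g w)"
        proof (rule AE_I2)
          fix w
          have "\<bar>g w\<bar> * \<bar>density_cdf f (- w)\<bar> \<le> \<bar>g w\<bar> * \<bar>If\<bar>"
            using cdf_bound[of "- w"] by (intro mult_left_mono) auto
          then show "norm (g w * density_cdf f (- w)) \<le> norm (If * g w)"
            by (simp add: abs_mult mult.commute)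
        qed
      qed measurable
      have i2: "integrable lborel (\<lambda>w. LINT u|lborel. g w * (indicator {0<..} u * h u * f (u - w)))"
        using lborel_pair.integrable_fst[of "\<lambda>w u. g w * (indicator {0<..} u * h u * f (u - w))"] int_gfh by simp
      have "g w * H w = h 0 * (g w * density_cdf f (- w))
          + (LINT u|lborel. g w * (indicator {0<..} u * h u * f (u - w)))" for w
        unfolding H_def integral_mult_right_zero distrib_left by (simp only: mult.left_commute)
      then have "(LINT w|lborel. g w * H w) = (LINT w|lborel. h 0 * (g w * density_cdf f (- w))
          + (LINT u|lborel. g w * (indicator {0<..} u * h u * f (u - w))))"
        by simp
      also have "\<dots> = h 0 * (LINT w|lborel. g w * density_cdf f (- w))
          + (LINT w|lborel. LINT u|lborel. g w * (indicator {0<..} u * h u * f (u - w)))"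
        using i1 i2 by (subst Bochner_Integration.integral_add) auto
      also have "(LINT w|lborel. LINT u|lborel. g w * (indicator {0<..} u * h u * f (u - w)))
          = (LINT u|lborel. LINT w|lborel. g w * (indicator {0<..} u * h u * f (u - w)))"
        by (rule lborel_pair.Fubini_integral[symmetric]) (use int_gfh in simp)
      also have "\<dots> = (LINT u|lborel. indicator {0<..} u * h u * (LINT w|lborel. g w * f (u - w)))"
        unfolding integral_mult_right_zero[symmetric]
        by (intro Bochner_Integration.integral_cong refl) (simp only: mult_ac)
      finally show ?thesis .
    qed
    also have "c * H a + (h 0 * (LINT w|lborel. g w * density_cdf f (- w))
          + (LINT u|lborel. indicator {0<..} u * h u * (LINT w|lborel. g w * f (u - w))))
       = (c * density_cdf f (- a) + (LINT w|lborel. g w * density_cdf f (- w))) * h 0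
         + ((LINT u|lborel. c * (indicator {0<..} u * h u * f (u - a)))
         + (LINT u|lborel. indicator {0<..} u * h u * (LINT w|lborel. g w * f (u - w))))"
      unfolding H_def integral_mult_right_zero by (simp add: distrib_left distrib_right mult_ac)
    also have "(LINT u|lborel. c * (indicator {0<..} u * h u * f (u - a)))
         + (LINT u|lborel. indicator {0<..} u * h u * (LINT w|lborel. g w * f (u - w)))
       = (LINT u|lborel. indicator {0<..} u * G u * h u)"
    proof (subst Bochner_Integration.integral_add[symmetric])
      show "integrable lborel (\<lambda>u. c * (indicator {0<..} u * h u * f (u - a)))"
        by (intro integrable_mult_right step(2))
      have [measurable]: "(\<lambda>u. LINT w|lborel. g w * f (u - w)) \<in> borel_measurable borel"
        by measurable
      show "integrable lborel (\<lambda>u. indicator {0<..} u * h u * (LINT w|lborel. g w * f (u - w)))"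
        by (rule Bochner_Integration.integrable_bound[OF integrable_mult_right[OF int_conv, of K]])
          (use hK K0 in \<open>auto simp: abs_mult indicator_def intro!: AE_I2 mult_right_mono\<close>)
    qed (auto simp: G_def distrib_left distrib_right mult_ac)
    finally show ?thesis .
  qed
  show ?thesis
    unfolding mixed_law_def G_def[symmetric]
    using int_new main by (auto simp: G_def[symmetric])
qed

text \<open>\<open>W\<^sub>n\<close> depends on the increments \<open>Z 1, \<dots>, Z n\<close> only. To see it as a measurable function of this
  finite family, the recursion is run with the coordinate functions as increments.\<close>

lemma lindley_indep_next:
  assumes "prob_space M" and ind: "prob_space.indep_vars M (\<lambda>_. borel) Z {1..}"
  shows "prob_space.indep_var M borel (lindley x Z n) borel (Z (Suc n))"
proof -
  interpret prob_space M by fact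
  define path where "path = lindley x (\<lambda>i z. z i :: real)"
  have path_meas: "m \<le> n \<Longrightarrow> path m \<in> borel_measurable (Pi\<^sub>M {1..n} (\<lambda>_. borel))" for m
  proof (induction m)
    case (Suc m)
    then have [measurable]: "path m \<in> borel_measurable (Pi\<^sub>M {1..n} (\<lambda>_. borel))"
      "(\<lambda>z. z (Suc m)) \<in> borel_measurable (Pi\<^sub>M {1..n} (\<lambda>_. borel :: real measure))"
      by (auto intro!: measurable_component_singleton)
    have "path (Suc m) = (\<lambda>z. max 0 (path m z + z (Suc m)))"
      by (auto simp: path_def)
    then show ?case by (simp only:) measurable
  next
    case 0
    have "path 0 = (\<lambda>_. x)" by (auto simp: path_def)
    then show ?case by simp
  qed
  have path_eq: "m \<le> n \<Longrightarrow> path m (restrict (\<lambda>i. Z i \<omega>) {1..n}) = lindley x Z m \<omega>" for m \<omega>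
    by (induction m) (auto simp: path_def)
  have "indep_var borel (path n \<circ> (\<lambda>\<omega>. restrict (\<lambda>i. Z i \<omega>) {1..n}))
          borel ((\<lambda>z. z (Suc n)) \<circ> (\<lambda>\<omega>. restrict (\<lambda>i. Z i \<omega>) {Suc n}))"
    by (rule indep_var_compose[OF indep_var_restrict[OF ind]])
      (auto intro!: path_meas measurable_component_singleton simp del: One_nat_def)
  also have "path n \<circ> (\<lambda>\<omega>. restrict (\<lambda>i. Z i \<omega>) {1..n}) = lindley x Z n"
    using path_eq[of n] by auto
  also have "(\<lambda>z. z (Suc n)) \<circ> (\<lambda>\<omega>. restrict (\<lambda>i. Z i \<omega>) {Suc n}) = Z (Suc n)"
    by auto
  finally show ?thesis .
qed

section \<open>Distributional derivatives of distribution functions\<close>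

lemma test_function_regular:
  assumes "test_function \<phi>"
  shows "\<And>u. (\<phi> has_real_derivative deriv \<phi> u) (at u)" "continuous_on UNIV (deriv \<phi>)"
    and "\<exists>B. \<forall>u. B \<le> \<bar>u\<bar> \<longrightarrow> \<phi> u = 0 \<and> deriv \<phi> u = 0"
proof -
  have diff: "(deriv ^^ k) \<phi> differentiable_on UNIV" for k
    using assms by (simp add: test_function_def)
  show D: "(\<phi> has_real_derivative deriv \<phi> u) (at u)" for u
    using diff[of 0] by (simp add: differentiable_on_def DERIV_deriv_iff_real_differentiable)
  show "continuous_on UNIV (deriv \<phi>)"
    using differentiable_imp_continuous_on[OF diff[of 1]] by simp
  have "bounded (closure {u. \<phi> u \<noteq> 0})"
    using assms by (simp add: test_function_def compact_imp_bounded)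
  then obtain B where B: "\<And>u. u \<in> closure {u. \<phi> u \<noteq> 0} \<Longrightarrow> \<bar>u\<bar> \<le> B"
    by (auto simp: bounded_iff)
  have "\<phi> u = 0 \<and> deriv \<phi> u = 0" if u: "B + 1 \<le> \<bar>u\<bar>" for u
  proof -
    \<comment> \<open>\<open>\<phi>\<close> vanishes on this open set, hence so does its derivative there.\<close>
    let ?S = "- closure {u. \<phi> u \<noteq> 0}"
    have zero: "\<phi> v = 0" if "v \<in> ?S" for v
      using that closure_subset[of "{u. \<phi> u \<noteq> 0}"] by blast
    have uS: "u \<in> ?S" using B[of u] u by auto
    have "((\<lambda>_. 0) has_real_derivative deriv \<phi> u) (at u)"
      by (rule has_field_derivative_transform_within_open[OF D _ uS zero]) auto
    from DERIV_unique[OF this DERIV_const] zero[OF uS] show ?thesis by simp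
  qed
  then show "\<exists>B. \<forall>u. B \<le> \<bar>u\<bar> \<longrightarrow> \<phi> u = 0 \<and> deriv \<phi> u = 0" by blast
qed

text \<open>\<open>\<P>(X \<le> u)\<close> is the expectation of the indicator of \<open>X \<le> u\<close>; after exchanging integrals, the inner
  integral of \<open>\<phi>'\<close> over \<open>[X, \<infinity>)\<close> is \<open>- \<phi>(X)\<close> by compact support.\<close>

lemma distributional_deriv_cdf:
  assumes M: "prob_space M" and X: "X \<in> borel_measurable M" and \<phi>: "test_function \<phi>"
  shows "distributional_deriv (\<lambda>u. \<P>(\<omega> in M. X \<omega> \<le> u)) \<phi> = (LINT \<omega>|M. \<phi> (X \<omega>))"
proof -
  interpret prob_space M by fact
  interpret P: pair_sigma_finite M "lborel :: real measure" ..
  note [measurable] = X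
  note D = test_function_regular(1)[OF \<phi>] and cont = test_function_regular(2)[OF \<phi>]
  obtain B where B: "\<And>u. B \<le> \<bar>u\<bar> \<Longrightarrow> \<phi> u = 0" "\<And>u. B \<le> \<bar>u\<bar> \<Longrightarrow> deriv \<phi> u = 0"
    using test_function_regular(3)[OF \<phi>] by blast
  have [measurable]: "deriv \<phi> \<in> borel_measurable borel"
    using cont by (rule borel_measurable_continuous_onI)
  have cont_at: "isCont (deriv \<phi>) u" for u
    using cont by (simp add: continuous_on_eq_continuous_at)
  have ftc: "has_bochner_integral lborel (\<lambda>u. indicator {a..} u * deriv \<phi> u) (- \<phi> a)" for a
  proof -
    \<comment> \<open>Beyond \<open>b\<close> both \<open>\<phi>\<close> and its derivative vanish, so the half-line may be cut there.\<close>
    define b where "b = max a B"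
    have "has_bochner_integral lborel (\<lambda>u. deriv \<phi> u * indicator {a..b} u) (\<phi> b - \<phi> a)"
      by (rule has_bochner_integral_FTC_Icc_real) (auto simp: b_def D cont_at)
    moreover have "\<phi> b = 0" using B(1)[of b] by (simp add: b_def)
    moreover have "deriv \<phi> u * indicator {a..b} u = indicator {a..} u * deriv \<phi> u" for u
      using B(2)[of u] by (auto simp: b_def indicator_def)
    ultimately show ?thesis by simp
  qed
  have int: "integrable lborel (deriv \<phi>)"
  proof -
    have "integrable lborel (\<lambda>u. indicator {- B..} u * deriv \<phi> u)"
      using ftc by (simp add: has_bochner_integral_iff)
    moreover have "indicator {- B..} u * deriv \<phi> u = deriv \<phi> u" for u
      using B(2)[of u] by (auto simp: indicator_def)
    ultimately show ?thesis by simp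
  qed
  define k where "k \<omega> u = indicator {X \<omega>..} u * deriv \<phi> u" for \<omega> u
  have k_int: "integrable (M \<Otimes>\<^sub>M lborel) (case_prod k)"
  proof (rule P.Fubini_integrable)
    show "case_prod k \<in> borel_measurable (M \<Otimes>\<^sub>M lborel)"
      unfolding k_def indicator_def atLeast_def by measurable
    then have meas: "(\<lambda>\<omega>. LINT u|lborel. norm (case_prod k (\<omega>, u))) \<in> borel_measurable M"
      by measurable
    show "integrable M (\<lambda>\<omega>. LINT u|lborel. norm (case_prod k (\<omega>, u)))"
    proof (rule integrable_const_bound[OF _ meas], rule AE_I2)
      fix \<omega>
      have "(LINT u|lborel. norm (case_prod k (\<omega>, u))) \<le> (LINT u|lborel. norm (deriv \<phi> u))"
        by (rule integral_mono)
          (use ftc[of "X \<omega>"] int in \<open>auto simp: k_def has_bochner_integral_iff indicator_def\<close>)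
      then show "norm (LINT u|lborel. norm (case_prod k (\<omega>, u))) \<le> (LINT u|lborel. norm (deriv \<phi> u))"
        by simp
    qed
    show "AE \<omega> in M. integrable lborel (\<lambda>u. case_prod k (\<omega>, u))"
      using ftc by (simp add: k_def has_bochner_integral_iff)
  qed
  have cdf: "\<P>(\<omega> in M. X \<omega> \<le> u) * deriv \<phi> u = (LINT \<omega>|M. k \<omega> u)" for u
  proof -
    have "\<P>(\<omega> in M. X \<omega> \<le> u) = (LINT \<omega>|M. indicator {\<omega> \<in> space M. X \<omega> \<le> u} \<omega>)"
      by simp
    also have "\<dots> = (LINT \<omega>|M. indicator {X \<omega>..} u)"
      by (intro Bochner_Integration.integral_cong) (auto simp: indicator_def)
    finally show ?thesis by (simp add: k_def)
  qed
  have "(LINT u|lborel. \<P>(\<omega> in M. X \<omega> \<le> u) * deriv \<phi> u) = (LINT u|lborel. LINT \<omega>|M. k \<omega> u)"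
    by (simp only: cdf)
  also have "\<dots> = (LINT \<omega>|M. LINT u|lborel. k \<omega> u)"
    by (rule P.Fubini_integral[OF k_int])
  also have "\<dots> = (LINT \<omega>|M. - \<phi> (X \<omega>))"
    using ftc by (simp add: k_def has_bochner_integral_iff)
  finally show ?thesis
    by (simp add: distributional_deriv_def)
qed

lemma mixed_law_has_density:
  assumes "prob_space M" and X: "mixed_law M X a c g"
  shows "has_density M X (\<lambda>\<phi>. c * dirac a \<phi> + fun_distribution g \<phi>)"
  unfolding has_density_def
proof (intro allI impI)
  fix \<phi> assume \<phi>: "test_function \<phi>"
  note D = test_function_regular(1)[OF \<phi>]
  have cont: "continuous_on UNIV \<phi>"
    using D by (intro continuous_at_imp_continuous_on ballI DERIV_isCont)
  obtain B where B: "\<And>u. B \<le> \<bar>u\<bar> \<Longrightarrow> \<phi> u = 0"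
    using test_function_regular(3)[OF \<phi>] by blast
  have "bounded (\<phi> ` {- B..B})"
    by (intro compact_imp_bounded compact_continuous_image continuous_on_subset[OF cont]) auto
  then obtain K where K: "\<And>u. u \<in> {- B..B} \<Longrightarrow> \<bar>\<phi> u\<bar> \<le> K"
    unfolding bounded_iff by force
  have "\<bar>\<phi> u\<bar> \<le> max K 0" for u
    using K[of u] B[of u] by (cases "u \<in> {- B..B}") auto
  then have "(LINT \<omega>|M. \<phi> (X \<omega>)) = c * \<phi> a + (LINT u|lborel. g u * \<phi> u)"
    using cont by (intro mixed_lawD[OF X] borel_measurable_continuous_onI)
  then show "distributional_deriv (\<lambda>u. \<P>(\<omega> in M. X \<omega> \<le> u)) \<phi> = c * dirac a \<phi> + fun_distribution g \<phi>"
    using X \<phi> assms(1) by (simp add: distributional_deriv_cdf mixed_law_def dirac_def fun_distribution_def)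
qed

section \<open>The recursion for the coefficients\<close>

text \<open>The ordinary part of \<open>W\<^sub>n\<close> is a combination of these functions with \<open>q = (n - 1)\<mu>\<close>.\<close>

definition ordinary_basis :: "real \<Rightarrow> real \<Rightarrow> nat \<Rightarrow> real \<Rightarrow> real" where
  "ordinary_basis \<sigma> q k w = indicator {0<..} w * ((w - q) ^ k * exp (- (1 / \<sigma>) * w))"

lemma ordinary_part_basis:
  "ordinary_part \<sigma> \<mu> x n u = 1 / (2 * \<sigma>) ^ n *
     (\<Sum>k = 0..n - 1. coeff_b \<sigma> \<mu> x n k * ordinary_basis \<sigma> ((real n - 1) * \<mu>) k u)"
  unfolding ordinary_part_def ordinary_basis_def sum_distrib_left sum_distrib_right
  by (intro sum.cong refl) simp

text \<open>The distribution function at \<open>- w\<close> is \<open>1 - exp ((w + \<mu>)/\<sigma>)/2\<close> for \<open>w \<le> - \<mu>\<close> and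
  \<open>exp (-(w + \<mu>)/\<sigma>)/2\<close> beyond. The three lines of the value come from the constant 1 on the first
  piece, from the exponential on it, which cancels \<open>exp (-w/\<sigma>)\<close>, and from the second piece.\<close>

lemma integral_basis_cdf:
  assumes "\<sigma> > 0" "q \<le> 0" "\<mu> \<le> 0"
  shows "has_bochner_integral lborel
      (\<lambda>w. ordinary_basis \<sigma> q k w * density_cdf (laplace_density \<mu> \<sigma>) (- w))
      (exp (- q / \<sigma>) * \<sigma> ^ (k + 1) * (gamma_tail k ((0 - q) / \<sigma>) - gamma_tail k ((- \<mu> - q) / \<sigma>))
       - exp (\<mu> / \<sigma>) / 2 * (((- \<mu> - q) ^ (k + 1) - (0 - q) ^ (k + 1)) / real (k + 1))
       + exp (- \<mu> / \<sigma>) / 2 * (exp (- 2 * q / \<sigma>) * \<sigma> ^ (k + 1) / 2 ^ (k + 1) * gamma_tail k (2 * (- \<mu> - q) / \<sigma>)))"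
    (is "has_bochner_integral lborel ?f ?I")
proof -
  let ?tail = "\<lambda>a p w. indicator {p<..} w * ((w - q) ^ k * exp (- a * w))"
  let ?pow = "\<lambda>w. indicator {0<..- \<mu>} w * (w - q) ^ k"
  have "has_bochner_integral lborel
      (\<lambda>w. (?tail (1 / \<sigma>) 0 w - ?tail (1 / \<sigma>) (- \<mu>) w) - exp (\<mu> / \<sigma>) / 2 * ?pow w
        + exp (- \<mu> / \<sigma>) / 2 * ?tail (2 / \<sigma>) (- \<mu>) w)
      ((exp (- (1 / \<sigma>) * q) / (1 / \<sigma>) ^ (k + 1) * gamma_tail k (1 / \<sigma> * (0 - q))
          - exp (- (1 / \<sigma>) * q) / (1 / \<sigma>) ^ (k + 1) * gamma_tail k (1 / \<sigma> * (- \<mu> - q)))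
        - exp (\<mu> / \<sigma>) / 2 * (((- \<mu> - q) ^ (k + 1) - (0 - q) ^ (k + 1)) / real (k + 1))
        + exp (- \<mu> / \<sigma>) / 2 * (exp (- (2 / \<sigma>) * q) / (2 / \<sigma>) ^ (k + 1) * gamma_tail k (2 / \<sigma> * (- \<mu> - q))))"
    (is "has_bochner_integral lborel ?g ?J")
    using assms
    by (intro has_bochner_integral_add has_bochner_integral_diff has_bochner_integral_mult_right
        has_bochner_integral_gamma_tail has_bochner_integral_shifted_power) auto
  moreover have "?g w = ?f w" for w
  proof -
    consider "w \<le> 0" | "0 < w" "w \<le> - \<mu>" | "- \<mu> < w" "0 < w" using assms by linarith
    then show ?thesis
    proof cases
      case 1
      then show ?thesis using assms by (simp add: ordinary_basis_def)
    next
      case 2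
      have "exp (- (1 / \<sigma>) * w) * exp ((\<mu> - - w) / \<sigma>) = exp (\<mu> / \<sigma>)"
        by (simp add: exp_add[symmetric] add_divide_distrib)
      then have "?f w = (w - q) ^ k * exp (- (1 / \<sigma>) * w) - exp (\<mu> / \<sigma>) / 2 * (w - q) ^ k"
        using 2 assms by (simp add: ordinary_basis_def density_cdf_laplace_ge right_diff_distrib mult.assoc)
      then show ?thesis using 2 assms by simp
    next
      case 3
      have "exp (- (1 / \<sigma>) * w) * exp ((- w - \<mu>) / \<sigma>) = exp (- \<mu> / \<sigma>) * exp (- (2 / \<sigma>) * w)"
        by (simp add: exp_add[symmetric] diff_divide_distrib)
      then have "?f w = exp (- \<mu> / \<sigma>) / 2 * ((w - q) ^ k * exp (- (2 / \<sigma>) * w))"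
        using 3 assms by (simp add: ordinary_basis_def density_cdf_laplace_le mult.assoc)
      then show ?thesis using 3 assms by simp
    qed
  qed
  moreover have "?J = ?I"
    using assms by (simp add: power_divide right_diff_distrib diff_divide_distrib)
  ultimately show ?thesis by (simp only:)
qed

text \<open>For \<open>w \<le> u - \<mu>\<close> the product of the exponentials does not depend on \<open>w\<close>, and a power is integrated;
  beyond, the exponentials combine to rate \<open>2/\<sigma>\<close>. Both pieces carry the factor \<open>exp (-(u - \<mu>)/\<sigma>)\<close>,
  the second one because \<open>\<Gamma>(k + 1, \<cdot>)\<close> at the kink contains \<open>exp (-2(u - \<mu> - q)/\<sigma>)\<close>.\<close>

lemma integral_basis_laplace:
  assumes "\<sigma> > 0" "q \<le> 0" "\<mu> \<le> u"
  shows "has_bochner_integral lborel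
      (\<lambda>w. ordinary_basis \<sigma> q k w * laplace_density \<mu> \<sigma> (u - w))
      (exp (\<mu> / \<sigma>) * exp (- u / \<sigma>) / (2 * \<sigma>)
        * (((u - \<mu> - q) ^ (k + 1) - (- q) ^ (k + 1)) / real (k + 1)
           + (\<Sum>i\<le>k. fact k / fact i * (u - \<mu> - q) ^ i * (\<sigma> / 2) ^ (k + 1 - i))))"
    (is "has_bochner_integral lborel ?f ?I")
proof -
  define v where "v = u - \<mu> - q"
  define E where "E = exp (\<mu> / \<sigma>) * exp (- u / \<sigma>) / (2 * \<sigma>)"
  define E' where "E' = exp ((u - \<mu>) / \<sigma>) / (2 * \<sigma>)"
  have "has_bochner_integral lborel
      (\<lambda>w. E * (indicator {0<..u - \<mu>} w * (w - q) ^ k)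
        + E' * (indicator {u - \<mu><..} w * ((w - q) ^ k * exp (- (2 / \<sigma>) * w))))
      (E * (((u - \<mu> - q) ^ (k + 1) - (0 - q) ^ (k + 1)) / real (k + 1))
        + E' * (exp (- (2 / \<sigma>) * q) / (2 / \<sigma>) ^ (k + 1) * gamma_tail k (2 / \<sigma> * (u - \<mu> - q))))"
    (is "has_bochner_integral lborel ?g ?J")
    using assms
    by (intro has_bochner_integral_add has_bochner_integral_mult_right
        has_bochner_integral_gamma_tail has_bochner_integral_shifted_power) auto
  moreover have "?g w = ?f w" for w
  proof -
    consider "w \<le> 0" | "0 < w" "w \<le> u - \<mu>" | "u - \<mu> < w" "0 < w" using assms by linarith
    then show ?thesis
    proof cases
      case 1
      then show ?thesis using assms by (simp add: ordinary_basis_def)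
    next
      case 2
      have "exp (- (1 / \<sigma>) * w) * exp (- (u - w - \<mu>) / \<sigma>) = exp (\<mu> / \<sigma>) * exp (- u / \<sigma>)"
        by (simp add: exp_add[symmetric] diff_divide_distrib)
      then show ?thesis
        using 2 assms by (simp add: ordinary_basis_def laplace_density_def E_def mult_ac)
    next
      case 3
      have "exp (- (1 / \<sigma>) * w) * exp ((u - w - \<mu>) / \<sigma>) = exp ((u - \<mu>) / \<sigma>) * exp (- (2 / \<sigma>) * w)"
        by (simp add: exp_add[symmetric] diff_divide_distrib)
      then show ?thesis
        using 3 assms by (simp add: ordinary_basis_def laplace_density_def E'_def mult_ac)
    qed
  qed
  moreover have "E' * (exp (- (2 / \<sigma>) * q) / (2 / \<sigma>) ^ (k + 1) * gamma_tail k (2 / \<sigma> * v))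
      = E * (\<Sum>i\<le>k. fact k / fact i * v ^ i * (\<sigma> / 2) ^ (k + 1 - i))"
  proof -
    have "exp ((u - \<mu>) / \<sigma>) * exp (- (2 / \<sigma>) * q) * exp (- (2 / \<sigma> * v)) = exp (\<mu> / \<sigma>) * exp (- u / \<sigma>)"
      unfolding v_def exp_add[symmetric] using assms by (simp add: field_simps)
    then have "E' * exp (- (2 / \<sigma>) * q) * exp (- (2 / \<sigma> * v)) = E"
      by (simp add: E_def E'_def)
    moreover have "1 / (2 / \<sigma>) ^ (k + 1) * (\<Sum>i\<le>k. fact k / fact i * (2 / \<sigma> * v) ^ i)
        = (\<Sum>i\<le>k. fact k / fact i * v ^ i * (\<sigma> / 2) ^ (k + 1 - i))"
      unfolding sum_distrib_left
    proof (rule sum.cong[OF refl])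
      fix i assume "i \<in> {..k}"
      then have split: "(\<sigma> / 2) ^ (k + 1) = (\<sigma> / 2) ^ (k + 1 - i) * (\<sigma> / 2) ^ i"
        by (simp add: power_add[symmetric])
      have inv: "(\<sigma> / 2) ^ i * (2 / \<sigma>) ^ i = 1"
        using assms by (simp add: power_mult_distrib[symmetric])
      have "1 / (2 / \<sigma>) ^ (k + 1) * (fact k / fact i * (2 / \<sigma> * v) ^ i)
          = (\<sigma> / 2) ^ (k + 1) * (fact k / fact i * ((2 / \<sigma>) ^ i * v ^ i))"
        by (simp only: power_mult_distrib power_one_over[symmetric]) (simp add: power_divide)
      also have "\<dots> = (\<sigma> / 2) ^ (k + 1 - i) * ((\<sigma> / 2) ^ i * (2 / \<sigma>) ^ i) * (fact k / fact i * v ^ i)"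
        unfolding split by (simp only: mult_ac)
      finally show "1 / (2 / \<sigma>) ^ (k + 1) * (fact k / fact i * (2 / \<sigma> * v) ^ i)
          = fact k / fact i * v ^ i * (\<sigma> / 2) ^ (k + 1 - i)"
        unfolding inv by (simp only: mult_ac mult_1_right)
    qed
    moreover have "E' * (exp (- (2 / \<sigma>) * q) / (2 / \<sigma>) ^ (k + 1) * gamma_tail k (2 / \<sigma> * v))
        = (E' * exp (- (2 / \<sigma>) * q) * exp (- (2 / \<sigma> * v)))
          * (1 / (2 / \<sigma>) ^ (k + 1) * (\<Sum>i\<le>k. fact k / fact i * (2 / \<sigma> * v) ^ i))"
      unfolding gamma_tail_def by (simp only: mult_ac times_divide_eq_left times_divide_eq_right mult_1_left mult_1_right)
    ultimately show ?thesis by (simp only:)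
  qed
  ultimately show ?thesis
    unfolding v_def E_def by (simp only: diff_0 distrib_left)
qed

text \<open>The term \<open>v\<^bsup>k+1\<^esup>/(k + 1)\<close> is the summand \<open>i = k + 1\<close> missing from the inner sum. With it absorbed,
  exchanging the order of summation gives the coefficient of each power of \<open>v\<close>.\<close>

lemma collect_powers:
  fixes b :: "nat \<Rightarrow> real" and r s v d :: real
  assumes "n \<ge> 1"
  shows "(\<Sum>k = 0..n - 1. b k * ((v ^ (k + 1) - r ^ (k + 1)) / real (k + 1)
            + (\<Sum>i\<le>k. fact k / fact i * v ^ i * s ^ (k + 1 - i)))) + d
    = (\<Sum>j = 0..n. (if j = 0
          then (\<Sum>k = 0..n - 1. b k * (- (r ^ (k + 1) / real (k + 1)) + fact k * s ^ (k + 1))) + d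
          else (\<Sum>k = j - 1..n - 1. b k * (fact k / fact j) * s ^ (k + 1 - j))) * v ^ j)"
proof -
  let ?m = "\<lambda>k j. b k * (fact k / fact j) * s ^ (k + 1 - j) * v ^ j"
  have summand: "b k * ((v ^ (k + 1) - r ^ (k + 1)) / real (k + 1)
            + (\<Sum>i\<le>k. fact k / fact i * v ^ i * s ^ (k + 1 - i)))
     = b k * (- (r ^ (k + 1) / real (k + 1)) + fact k * s ^ (k + 1)) + (\<Sum>j\<in>{j \<in> {1..n}. j \<le> k + 1}. ?m k j)"
    if "k \<in> {0..n - 1}" for k
  proof -
    have set: "{j \<in> {1..n}. j \<le> k + 1} = insert (k + 1) {1..k}"
      using that assms by auto
    have split0: "{..k} = insert 0 {1..k}" by auto
    have "v ^ (k + 1) / real (k + 1) = fact k / fact (k + 1) * v ^ (k + 1)"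
      by (simp add: divide_simps)
    moreover have "(\<Sum>i = 1..k. ?m k i) = b k * (\<Sum>i = 1..k. fact k / fact i * v ^ i * s ^ (k + 1 - i))"
      unfolding sum_distrib_left by (intro sum.cong refl) (simp only: mult_ac)
    ultimately show ?thesis
      unfolding set split0 by (simp add: diff_divide_distrib distrib_left right_diff_distrib del: power_Suc fact_Suc of_nat_Suc)
  qed
  have "(\<Sum>k = 0..n - 1. b k * ((v ^ (k + 1) - r ^ (k + 1)) / real (k + 1)
            + (\<Sum>i\<le>k. fact k / fact i * v ^ i * s ^ (k + 1 - i))))
     = (\<Sum>k = 0..n - 1. b k * (- (r ^ (k + 1) / real (k + 1)) + fact k * s ^ (k + 1)))
       + (\<Sum>k = 0..n - 1. \<Sum>j\<in>{j \<in> {1..n}. j \<le> k + 1}. ?m k j)"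
    unfolding sum.distrib[symmetric] by (intro sum.cong refl summand)
  also have "(\<Sum>k = 0..n - 1. \<Sum>j\<in>{j \<in> {1..n}. j \<le> k + 1}. ?m k j)
      = (\<Sum>j = 1..n. \<Sum>k\<in>{k \<in> {0..n - 1}. j \<le> k + 1}. ?m k j)"
    by (rule sum.swap_restrict) auto
  also have "\<dots> = (\<Sum>j = 1..n. (\<Sum>k = j - 1..n - 1. b k * (fact k / fact j) * s ^ (k + 1 - j)) * v ^ j)"
    unfolding sum_distrib_right by (intro sum.cong refl) auto
  finally have eq: "(\<Sum>k = 0..n - 1. b k * ((v ^ (k + 1) - r ^ (k + 1)) / real (k + 1)
            + (\<Sum>i\<le>k. fact k / fact i * v ^ i * s ^ (k + 1 - i))))
     = (\<Sum>k = 0..n - 1. b k * (- (r ^ (k + 1) / real (k + 1)) + fact k * s ^ (k + 1)))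
       + (\<Sum>j = 1..n. (\<Sum>k = j - 1..n - 1. b k * (fact k / fact j) * s ^ (k + 1 - j)) * v ^ j)" .
  have "{0..n} = insert 0 {1..n}" by auto
  then show ?thesis
    unfolding eq by (simp del: fact_Suc of_nat_Suc power_Suc)
qed

text \<open>The three sums of the recursion are the three pieces of \<open>integral_basis_cdf\<close>, with
  \<open>\<Gamma>\<close> evaluated at nonnegative arguments; the coefficient of \<open>c\<^sub>n\<close> is the probability that an
  increment is at most 0.\<close>

lemma coeff_c_step:
  assumes "\<sigma> > 0" "\<mu> \<le> 0" "n \<ge> 1"
  shows "coeff_c \<sigma> \<mu> x n * density_cdf (laplace_density \<mu> \<sigma>) (- 0)
     + (LINT w|lborel. ordinary_part \<sigma> \<mu> x n w * density_cdf (laplace_density \<mu> \<sigma>) (- w))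
     = coeff_c \<sigma> \<mu> x (Suc n)"
proof -
  define q where "q = (real n - 1) * \<mu>"
  have q: "q \<le> 0" using assms by (simp add: q_def mult_nonneg_nonpos)
  define b where "b = coeff_b \<sigma> \<mu> x n"
  define A1 where "A1 k = exp (- q / \<sigma>) * \<sigma> ^ (k + 1) * (gamma_tail k ((0 - q) / \<sigma>) - gamma_tail k ((- \<mu> - q) / \<sigma>))" for k
  define A2 where "A2 k = ((- \<mu> - q) ^ (k + 1) - (0 - q) ^ (k + 1)) / real (k + 1)" for k
  define A3 where "A3 k = exp (- 2 * q / \<sigma>) * \<sigma> ^ (k + 1) / 2 ^ (k + 1) * gamma_tail k (2 * (- \<mu> - q) / \<sigma>)" for k
  note basis = integral_basis_cdf[OF assms(1) q assms(2)]
  have "has_bochner_integral lborel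
      (\<lambda>w. 1 / (2 * \<sigma>) ^ n * (\<Sum>k = 0..n - 1. b k * (ordinary_basis \<sigma> q k w * density_cdf (laplace_density \<mu> \<sigma>) (- w))))
      (1 / (2 * \<sigma>) ^ n * (\<Sum>k = 0..n - 1. b k * (A1 k - exp (\<mu> / \<sigma>) / 2 * A2 k + exp (- \<mu> / \<sigma>) / 2 * A3 k)))"
    unfolding A1_def A2_def A3_def
    by (intro has_bochner_integral_mult_right has_bochner_integral_sum basis)
  moreover have "ordinary_part \<sigma> \<mu> x n w * density_cdf (laplace_density \<mu> \<sigma>) (- w)
     = 1 / (2 * \<sigma>) ^ n * (\<Sum>k = 0..n - 1. b k * (ordinary_basis \<sigma> q k w * density_cdf (laplace_density \<mu> \<sigma>) (- w)))" for w
    by (simp add: ordinary_part_basis b_def q_def sum_distrib_right mult.assoc)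
  ultimately have int: "(LINT w|lborel. ordinary_part \<sigma> \<mu> x n w * density_cdf (laplace_density \<mu> \<sigma>) (- w))
     = 1 / (2 * \<sigma>) ^ n * (\<Sum>k = 0..n - 1. b k * (A1 k - exp (\<mu> / \<sigma>) / 2 * A2 k + exp (- \<mu> / \<sigma>) / 2 * A3 k))"
    by (simp add: has_bochner_integral_iff)
  have split: "(\<Sum>k = 0..n - 1. b k * (A1 k - exp (\<mu> / \<sigma>) / 2 * A2 k + exp (- \<mu> / \<sigma>) / 2 * A3 k))
     = (\<Sum>k = 0..n - 1. b k * A1 k) - exp (\<mu> / \<sigma>) / 2 * (\<Sum>k = 0..n - 1. b k * A2 k)
       + exp (- \<mu> / \<sigma>) / 2 * (\<Sum>k = 0..n - 1. b k * A3 k)"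
    unfolding sum_distrib_left sum_subtractf[symmetric] sum.distrib[symmetric]
    by (intro sum.cong refl) (simp add: distrib_left right_diff_distrib mult_ac)
  have nn: "0 \<le> 2 * (- \<mu> - q) / \<sigma>" "0 \<le> (- \<mu> - q) / \<sigma>" "0 \<le> (0 - q) / \<sigma>"
    using assms q by (auto intro!: divide_nonneg_pos simp del: diff_0)
  have centre: "- 2 * (real n - 1) * \<mu> = - 2 * q" "- (real n - 1) * \<mu> = - q"
    by (simp_all only: q_def mult.assoc mult_minus_left)
  have S3: "(\<Sum>k = 0..n - 1. coeff_b \<sigma> \<mu> x n k
                * (exp (- 2 * (real n - 1) * \<mu> / \<sigma>) * \<sigma> ^ (k + 1) / 2 ^ (k + 1))
                * (upper_Gamma (1 + k) \<infinity>
                   - upper_Gamma (1 + k) (ereal (2 * (- \<mu> - (real n - 1) * \<mu>) / \<sigma>))))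
      = - (\<Sum>k = 0..n - 1. b k * A3 k)"
    unfolding upper_Gamma_infinity centre q_def[symmetric] upper_Gamma_eq_gamma_tail[OF nn(1)] sum_negf[symmetric]
    by (intro sum.cong refl) (simp add: A3_def b_def mult.assoc)
  have S1: "(\<Sum>k = 0..n - 1. coeff_b \<sigma> \<mu> x n k
                * exp (- (real n - 1) * \<mu> / \<sigma>) * \<sigma> ^ (k + 1)
                * (upper_Gamma (1 + k) (ereal ((- \<mu> - (real n - 1) * \<mu>) / \<sigma>))
                   - upper_Gamma (1 + k) (ereal ((0 - (real n - 1) * \<mu>) / \<sigma>))))
      = - (\<Sum>k = 0..n - 1. b k * A1 k)"
    unfolding centre q_def[symmetric] upper_Gamma_eq_gamma_tail[OF nn(2)]
      upper_Gamma_eq_gamma_tail[OF nn(3)] sum_negf[symmetric]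
    by (intro sum.cong refl) (simp add: A1_def b_def right_diff_distrib mult.assoc)
  have S2: "(\<Sum>k = 0..n - 1. coeff_b \<sigma> \<mu> x n k
                * ((- \<mu> - (real n - 1) * \<mu>) ^ (k + 1) / real (k + 1)
                   - (0 - (real n - 1) * \<mu>) ^ (k + 1) / real (k + 1)))
      = (\<Sum>k = 0..n - 1. b k * A2 k)"
    unfolding A2_def b_def q_def diff_divide_distrib ..
  have c: "coeff_c \<sigma> \<mu> x (Suc n) =
       - (exp (- \<mu> / \<sigma>) / (2 ^ (n + 1) * \<sigma> ^ n)) * - (\<Sum>k = 0..n - 1. b k * A3 k)
       - 1 / (2 * \<sigma>) ^ n * - (\<Sum>k = 0..n - 1. b k * A1 k)
       - exp (\<mu> / \<sigma>) / (2 ^ (n + 1) * \<sigma> ^ n) * (\<Sum>k = 0..n - 1. b k * A2 k)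
       + (1 - exp (\<mu> / \<sigma>) / 2) * coeff_c \<sigma> \<mu> x n"
    unfolding coeff_c.simps S1 S2 S3 using assms(3) by (intro if_not_P) simp
  have F0: "density_cdf (laplace_density \<mu> \<sigma>) (- 0) = 1 - exp (\<mu> / \<sigma>) / 2"
    using density_cdf_laplace_ge[of \<sigma> \<mu> 0] assms by simp
  show ?thesis
    unfolding int split c F0 using assms(1)
    by (simp add: power_mult_distrib distrib_left right_diff_distrib left_diff_distrib mult_ac)
qed

text \<open>Convolving moves the centre of the polynomial from \<open>(n - 1)\<mu>\<close> to \<open>n\<mu>\<close>, and \<open>collect_powers\<close> reads
  off the new coefficients. The atom contributes \<open>c\<^sub>n f(u)\<close>, which is a constant times
  \<open>exp (-u/\<sigma>)\<close> for \<open>u > 0 \<ge> \<mu>\<close> and so enters the coefficient \<open>j = 0\<close> only.\<close>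

lemma ordinary_part_step:
  assumes "\<sigma> > 0" "\<mu> \<le> 0" "n \<ge> 1"
  shows "indicator {0<..} u * (coeff_c \<sigma> \<mu> x n * laplace_density \<mu> \<sigma> (u - 0)
     + (LINT w|lborel. ordinary_part \<sigma> \<mu> x n w * laplace_density \<mu> \<sigma> (u - w)))
     = ordinary_part \<sigma> \<mu> x (Suc n) u"
proof (cases "u > 0")
  case False
  then show ?thesis by (simp add: ordinary_part_def)
next
  case True
  define q where "q = (real n - 1) * \<mu>"
  have q: "q \<le> 0" using assms by (simp add: q_def mult_nonneg_nonpos)
  have u: "\<mu> \<le> u" using True assms by linarith
  define b where "b = coeff_b \<sigma> \<mu> x n"
  define E where "E = exp (\<mu> / \<sigma>) * exp (- u / \<sigma>) / (2 * \<sigma>)"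
  define v where "v = u - real n * \<mu>"
  have v: "u - \<mu> - q = v" by (simp add: v_def q_def algebra_simps)
  define T where "T k = (v ^ (k + 1) - (- q) ^ (k + 1)) / real (k + 1)
           + (\<Sum>i\<le>k. fact k / fact i * v ^ i * (\<sigma> / 2) ^ (k + 1 - i))" for k
  note basis = integral_basis_laplace[OF assms(1) q u, unfolded v, folded E_def T_def]
  have "has_bochner_integral lborel
      (\<lambda>w. 1 / (2 * \<sigma>) ^ n * (\<Sum>k = 0..n - 1. b k * (ordinary_basis \<sigma> q k w * laplace_density \<mu> \<sigma> (u - w))))
      (1 / (2 * \<sigma>) ^ n * (\<Sum>k = 0..n - 1. b k * (E * T k)))"
    by (intro has_bochner_integral_mult_right has_bochner_integral_sum basis)
  moreover have "ordinary_part \<sigma> \<mu> x n w * laplace_density \<mu> \<sigma> (u - w)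
     = 1 / (2 * \<sigma>) ^ n * (\<Sum>k = 0..n - 1. b k * (ordinary_basis \<sigma> q k w * laplace_density \<mu> \<sigma> (u - w)))" for w
    by (simp add: ordinary_part_basis b_def q_def sum_distrib_right mult.assoc)
  ultimately have "(LINT w|lborel. ordinary_part \<sigma> \<mu> x n w * laplace_density \<mu> \<sigma> (u - w))
     = 1 / (2 * \<sigma>) ^ n * (\<Sum>k = 0..n - 1. b k * (E * T k))"
    by (simp add: has_bochner_integral_iff)
  also have "\<dots> = E / (2 * \<sigma>) ^ n * (\<Sum>k = 0..n - 1. b k * T k)"
    by (simp add: sum_distrib_left mult_ac)
  finally have int: "(LINT w|lborel. ordinary_part \<sigma> \<mu> x n w * laplace_density \<mu> \<sigma> (u - w))
     = E / (2 * \<sigma>) ^ n * (\<Sum>k = 0..n - 1. b k * T k)" .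
  have L: "laplace_density \<mu> \<sigma> (u - 0) = E / (2 * \<sigma>) ^ n * (2 * \<sigma>) ^ n"
  proof -
    have "exp (- (u - \<mu>) / \<sigma>) = exp (\<mu> / \<sigma>) * exp (- u / \<sigma>)"
      by (simp add: exp_add[symmetric] diff_divide_distrib)
    then show ?thesis using assms u by (simp add: laplace_density_def E_def)
  qed
  define d where "d = (2 * \<sigma>) ^ n * coeff_c \<sigma> \<mu> x n"
  have "coeff_c \<sigma> \<mu> x n * laplace_density \<mu> \<sigma> (u - 0)
     + (LINT w|lborel. ordinary_part \<sigma> \<mu> x n w * laplace_density \<mu> \<sigma> (u - w))
     = E / (2 * \<sigma>) ^ n * ((\<Sum>k = 0..n - 1. b k * T k) + d)"
    unfolding int L d_def by (simp only: distrib_left mult_ac add_ac)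
  also have "(\<Sum>k = 0..n - 1. b k * T k) + d
     = (\<Sum>j = 0..n. (if j = 0
          then (\<Sum>k = 0..n - 1. b k * (- ((- q) ^ (k + 1) / real (k + 1)) + fact k * (\<sigma> / 2) ^ (k + 1))) + d
          else (\<Sum>k = j - 1..n - 1. b k * (fact k / fact j) * (\<sigma> / 2) ^ (k + 1 - j))) * v ^ j)"
    unfolding T_def by (rule collect_powers[OF assms(3)])
  also have "E / (2 * \<sigma>) ^ n * \<dots> = (\<Sum>j = 0..n. 1 / (2 * \<sigma>) ^ Suc n * coeff_b \<sigma> \<mu> x (Suc n) j * v ^ j * exp (- u / \<sigma>))"
    unfolding sum_distrib_left
  proof (intro sum.cong refl)
    fix j
    have "coeff_b \<sigma> \<mu> x (Suc n) j = exp (\<mu> / \<sigma>) * (if j = 0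
          then (\<Sum>k = 0..n - 1. b k * (- ((- q) ^ (k + 1) / real (k + 1)) + fact k * (\<sigma> / 2) ^ (k + 1))) + d
          else (\<Sum>k = j - 1..n - 1. b k * (fact k / fact j) * (\<sigma> / 2) ^ (k + 1 - j)))" (is "_ = _ * ?B")
    proof -
      have n: "(n = 0) = False" and r: "- (real n - 1) * \<mu> = - q"
        using assms(3) unfolding q_def by (simp_all only: mult_minus_left) simp
      show ?thesis
        by (cases "j = 0") (simp_all only: coeff_b.simps n r b_def d_def if_True if_False simp_thms)
    qed
    then show "E / (2 * \<sigma>) ^ n * (?B * v ^ j)
       = 1 / (2 * \<sigma>) ^ Suc n * coeff_b \<sigma> \<mu> x (Suc n) j * v ^ j * exp (- u / \<sigma>)"
      by (simp only: E_def power_Suc times_divide_eq_left times_divide_eq_right divide_divide_eq_left mult_1_left mult_1_right mult_ac)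
  qed
  also have "\<dots> = ordinary_part \<sigma> \<mu> x (Suc n) u"
    using True by (simp add: ordinary_part_def v_def)
  finally show ?thesis using True by simp
qed

section \<open>The law of the Lindley process\<close>

text \<open>The first step starts from the atom at \<open>x\<close>: \<open>\<mu> \<le> - x\<close> puts \<open>- x\<close> and all \<open>u - x\<close> with \<open>u > 0\<close>
  on the right branch of the Laplace density.\<close>

lemma mixed_law_lindley:
  fixes M :: "'a measure" and Z :: "nat \<Rightarrow> 'a \<Rightarrow> real" and \<sigma> \<mu> x :: real
  assumes M: "prob_space M"
    and ind: "prob_space.indep_vars M (\<lambda>_. borel) Z {1..}"
    and Z: "\<And>i. i \<ge> 1 \<Longrightarrow> distributed M lborel (Z i) (\<lambda>z. ennreal (laplace_density \<mu> \<sigma> z))"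
    and \<sigma>: "\<sigma> > 0" and \<mu>: "\<mu> \<le> - x" "\<mu> \<le> 0"
    and n: "n \<ge> 1"
  shows "mixed_law M (lindley x Z n) 0 (coeff_c \<sigma> \<mu> x n) (ordinary_part \<sigma> \<mu> x n)"
proof -
  have f: "integrable lborel (laplace_density \<mu> \<sigma>)" "\<And>z. laplace_density \<mu> \<sigma> z \<ge> 0"
    using laplace_density_total[OF \<sigma>] laplace_density_nonneg[OF \<sigma>]
    by (auto simp: has_bochner_integral_iff)
  have law_step: "mixed_law M (lindley x Z (Suc n)) 0
     (c * density_cdf (laplace_density \<mu> \<sigma>) (- a) + (LINT w|lborel. g w * density_cdf (laplace_density \<mu> \<sigma>) (- w)))
     (\<lambda>u. indicator {0<..} u * (c * laplace_density \<mu> \<sigma> (u - a) + (LINT w|lborel. g w * laplace_density \<mu> \<sigma> (u - w))))"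
    if "mixed_law M (lindley x Z n) a c g" for n a c g
  proof -
    have "lindley x Z (Suc n) = (\<lambda>\<omega>. max 0 (lindley x Z n \<omega> + Z (Suc n) \<omega>))" by auto
    then show ?thesis
      using mixed_law_lindley_step[OF M that lindley_indep_next[OF M ind] Z f] by simp
  qed
  show ?thesis
    using n
  proof (induction n rule: dec_induct)
    case base
    have "lindley x Z 0 = (\<lambda>_. x)" by auto
    then have law0: "mixed_law M (lindley x Z 0) x 1 (\<lambda>_. 0)"
      using mixed_law_const[OF M] by simp
    have "indicator {0<..} u * (1 * laplace_density \<mu> \<sigma> (u - x) + (LINT w|lborel. 0 * laplace_density \<mu> \<sigma> (u - w)))
        = ordinary_part \<sigma> \<mu> x 1 u" for u
    proof (cases "u > 0")
      case True
      have "exp (- (u - x - \<mu>) / \<sigma>) = exp ((\<mu> + x) / \<sigma>) * exp (- u / \<sigma>)"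
        by (simp add: exp_add[symmetric] diff_divide_distrib add_divide_distrib)
      with True \<mu> show ?thesis by (simp add: ordinary_part_def laplace_density_def)
    qed (simp add: ordinary_part_def)
    moreover have "1 * density_cdf (laplace_density \<mu> \<sigma>) (- x) + (LINT w|lborel. 0 * density_cdf (laplace_density \<mu> \<sigma>) (- w))
        = coeff_c \<sigma> \<mu> x 1"
      using \<sigma> \<mu> by (simp add: density_cdf_laplace_ge)
    ultimately show ?case using law_step[OF law0] by (simp only: One_nat_def)
  next
    case (step n)
    show ?case
      using law_step[OF step.IH] step.hyps \<sigma> \<mu> by (simp only: coeff_c_step ordinary_part_step)
  qed
qed

theorem theorem3p9:
  fixes M :: "'a measure" and Z :: "nat \<Rightarrow> 'a \<Rightarrow> real" and \<sigma> \<mu> x :: real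
  assumes "prob_space M"
    and "prob_space.indep_vars M (\<lambda>_. borel) Z {1..}"
    and "\<And>i. i \<ge> 1 \<Longrightarrow> distributed M lborel (Z i) (\<lambda>z. ennreal (laplace_density \<mu> \<sigma> z))"
    and "\<sigma> > 0" and "x > 0" and "\<mu> \<le> - x"
  shows "has_density M (lindley x Z 0) (dirac x) \<and>
         (\<forall>n\<ge>1.
           integrable lborel (ordinary_part \<sigma> \<mu> x n) \<and>
           has_density M (lindley x Z n)
             (\<lambda>\<phi>. coeff_c \<sigma> \<mu> x n * dirac 0 \<phi> + fun_distribution (ordinary_part \<sigma> \<mu> x n) \<phi>) \<and>
           \<P>(\<omega> in M. lindley x Z n \<omega> = 0) = coeff_c \<sigma> \<mu> x n)"
proof (intro conjI allI impI)
  have "lindley x Z 0 = (\<lambda>_. x)" by auto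
  then show "has_density M (lindley x Z 0) (dirac x)"
    using mixed_law_has_density[OF assms(1) mixed_law_const[OF assms(1)], of x]
    by (simp add: fun_distribution_def dirac_def has_density_def)
next
  fix n :: nat assume "n \<ge> 1"
  then have law: "mixed_law M (lindley x Z n) 0 (coeff_c \<sigma> \<mu> x n) (ordinary_part \<sigma> \<mu> x n)"
    using assms by (intro mixed_law_lindley) auto
  show "integrable lborel (ordinary_part \<sigma> \<mu> x n)"
    using law by (simp add: mixed_law_def)
  show "has_density M (lindley x Z n)
          (\<lambda>\<phi>. coeff_c \<sigma> \<mu> x n * dirac 0 \<phi> + fun_distribution (ordinary_part \<sigma> \<mu> x n) \<phi>)"
    by (rule mixed_law_has_density[OF assms(1) law])
  show "\<P>(\<omega> in M. lindley x Z n \<omega> = 0) = coeff_c \<sigma> \<mu> x n"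
    by (rule mixed_law_prob_atom[OF assms(1) law])
qed

end
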